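(* Let $\kappa\in(0,1)$, let $m\ge 0$ be an integer, let $n=2m+1$ and let $a=\frac1n$. Let $\phi$ and $\psi$ be the functions, analytic near $0$, associated with $\kappa$ and $a$ as in the context, and let $d=\cos\psi$, $c=\cos\phi$, $s=\sin\phi$. Then none of the squares $d^2$, $c^2$ and $s^2$ is elliptic; that is, for none of these three functions is there an elliptic function on $\mathbb{C}$ that agrees with it on a neighbourhood of $0$.
   Context: For a number $a$ write $F_a(z)=F(\tfrac12-a,\tfrac12+a;\tfrac12;z)$, where $F={}_2F_1$ is the Gauss hypergeometric function (given by its power series for $|z|<1$). Fix $\kappa\in(0,1)$. Since $F_a(0)=1$, the map $\phi\mapsto\int_0^{\phi}F_a(\kappa^2\sin^2\theta)\,\mathrm{d}\theta$ is locally invertible near its fixed point $0$; write $\phi$ for the analytic local inverse, so that $\phi(0)=0$ and $t=\int_0^{\phi(t)}F_a(\kappa^2\sin^2\theta)\,\mathrm{d}\theta$ for $t$ near $0$. Let $\psi$ be the function analytic near $0$ determined by $\sin\psi=\kappa\sin\phi$ and $\psi(0)=0$. An elliptic function is a meromorphic function on $\mathbb{C}$ having two $\mathbb{R}$-linearly independent periods. *)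

theory Defs
  imports "HOL-Complex_Analysis.Complex_Analysis"
begin

(* F(1/2 - a, 1/2 + a; 1/2; z). The last argument 1 of fps_hypergeo is the scaling of the
   variable. Only meaningful for norm z < 1, where the series converges. *)
definition hypF :: "complex \<Rightarrow> complex \<Rightarrow> complex" where
  "hypF a z = eval_fps (fps_hypergeo [1/2 - a, 1/2 + a] [1/2] 1) z"

(* The germ at 0 of the analytic inverse of the integral. The integral from 0 to phi t is taken
   along the straight segment; for t near 0 the integrand is holomorphic around that segment. *)
definition is_local_inverse :: "real \<Rightarrow> complex \<Rightarrow> (complex \<Rightarrow> complex) \<Rightarrow> bool" where
  "is_local_inverse \<kappa> a \<phi> \<longleftrightarrow>
     \<phi> analytic_on {0} \<and> \<phi> 0 = 0 \<and>
     (\<forall>\<^sub>F t in nhds 0.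
        ((\<lambda>\<theta>. hypF a ((of_real \<kappa>)\<^sup>2 * (sin \<theta>)\<^sup>2)) has_contour_integral t) (linepath 0 (\<phi> t)))"

definition is_amplitude_psi :: "real \<Rightarrow> (complex \<Rightarrow> complex) \<Rightarrow> (complex \<Rightarrow> complex) \<Rightarrow> bool" where
  "is_amplitude_psi \<kappa> \<phi> \<psi> \<longleftrightarrow>
     \<psi> analytic_on {0} \<and> \<psi> 0 = 0 \<and>
     (\<forall>\<^sub>F t in nhds 0. sin (\<psi> t) = of_real \<kappa> * sin (\<phi> t))"

(* "nicely" fixes the value 0 at poles and excludes spurious values at removable singularities,
   so periodicity can be demanded at every point. Here independent is linear independence over
   the reals; w1 \<noteq> w2 is needed since it speaks about the set {w1, w2}. *)
definition elliptic :: "(complex \<Rightarrow> complex) \<Rightarrow> bool" where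
  "elliptic f \<longleftrightarrow>
     f nicely_meromorphic_on UNIV \<and>
     (\<exists>w1 w2. w1 \<noteq> w2 \<and> independent {w1, w2} \<and>
        (\<forall>z. f (z + w1) = f z) \<and> (\<forall>z. f (z + w2) = f z))"

end

theory Submission
  imports Defs
begin

text \<open>
  Put \<open>g = 2 d\<^sup>2 - 1 = cos (2\<psi>)\<close> and \<open>x = cos (2a\<psi>)\<close>. The whole argument rests on the closed form
  \<open>F\<^sub>a (sin\<^sup>2 u) cos u = cos (2au)\<close> (\<open>hypF_sin_squared\<close>), which turns the definition of \<open>\<phi>\<close>
  into the differential equation \<open>\<psi>' cos (2a\<psi>) = \<kappa> cos \<phi>\<close> (\<open>amplitude_psi_deriv\<close>). With
  \<open>y = x\<^sup>2\<close> and \<open>l = 2\<kappa>\<^sup>2 - 1\<close> it yields (\<open>amplitude_germ\<close>)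
  \<open>y'\<^sup>2 = 8a\<^sup>2 (1 - y) (g + l)\<close> and \<open>y g'\<^sup>2 = 2 (1 - g\<^sup>2) (g + l)\<close>.

  Since \<open>a = 1/n\<close>, \<open>g\<close> is the Chebyshev polynomial \<open>T\<^sub>n\<close> of \<open>x\<close>, and for odd \<open>n\<close> this is
  \<open>x Q(x\<^sup>2)\<close> with \<open>Q(0) \<noteq> 0\<close> (\<open>cos_odd_multiple_eq_poly\<close>); hence \<open>g\<^sup>2 = y Q(y)\<^sup>2\<close>. Eliminating
  \<open>g\<close> from the first equation gives
  \<open>(y'\<^sup>2 / (8a\<^sup>2) - l (1 - y))\<^sup>2 = (1 - y)\<^sup>2 y Q(y)\<^sup>2\<close>,
  whose right-hand side has a simple root at \<open>y = 0\<close>.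

  Suppose that \<open>d\<^sup>2\<close> is elliptic. Then so are \<open>g\<close> and, by the second equation, \<open>y\<close>, and the last
  equation holds on the whole plane. A nonconstant elliptic function has a zero
  (\<open>elliptic_has_zero\<close>). But a nonconstant solution of an equation of this shape cannot take as
  its value a simple root of the right-hand side (\<open>simple_root_omitted_by_ode_solution\<close>): differentiate
  and cancel \<open>y'\<close>. This contradiction is \<open>cos_psi_squared_not_elliptic\<close>. The functions \<open>c\<^sup>2\<close>
  and \<open>s\<^sup>2\<close> reduce to \<open>d\<^sup>2\<close>, because \<open>d\<^sup>2 = 1 - \<kappa>\<^sup>2 s\<^sup>2 = 1 - \<kappa>\<^sup>2 + \<kappa>\<^sup>2 c\<^sup>2\<close>.
\<close>

section \<open>Cosines of odd multiples\<close>

text \<open>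
  The recurrence \<open>cos ((k + 2) u) + cos ((k - 2) u) = 2 cos (k u) cos (2u)\<close> preserves the form
  \<open>cos u\<close> times a polynomial in \<open>cos\<^sup>2 u\<close>, as \<open>cos (2u)\<close> is such a polynomial in \<open>cos\<^sup>2 u\<close>. The
  constant term is recorded because its being nonzero is what makes \<open>0\<close> a simple root later on.
\<close>

lemma cos_odd_multiple_eq_poly:
  "\<exists>Q :: complex poly. (\<forall>u. cos (of_nat (2 * m + 1) * u) = cos u * poly Q ((cos u)\<^sup>2)) \<and>
     poly Q 0 = (- 1) ^ m * of_nat (2 * m + 1)"
proof (induction m rule: induct_nat_012)
  case 0
  show ?case by (rule exI[of _ 1]) simp
next
  case 1
  have "cos (3 * u) = cos u * (4 * (cos u)\<^sup>2 - 3)" for u :: complex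
    unfolding cos_treble_cos by (simp add: power2_eq_square power3_eq_cube algebra_simps)
  then show ?case by (intro exI[of _ "[:- 3, 4:]"]) (auto simp: algebra_simps)
next
  case (ge2 m)
  from ge2 obtain P Q :: "complex poly" where
    P: "\<And>u. cos (of_nat (2 * m + 1) * u) = cos u * poly P ((cos u)\<^sup>2)"
       "poly P 0 = (- 1) ^ m * of_nat (2 * m + 1)" and
    Q: "\<And>u. cos (of_nat (2 * Suc m + 1) * u) = cos u * poly Q ((cos u)\<^sup>2)"
       "poly Q 0 = (- 1) ^ Suc m * of_nat (2 * Suc m + 1)"
    by blast
  have "cos (of_nat (2 * Suc (Suc m) + 1) * u) = cos u * poly ([:- 2, 4:] * Q - P) ((cos u)\<^sup>2)"
    for u :: complex
  proof -
    have "cos (of_nat (2 * Suc (Suc m) + 1) * u) + cos (of_nat (2 * m + 1) * u)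
        = 2 * cos (of_nat (2 * Suc m + 1) * u) * cos (2 * u)"
      using cos_plus_cos[of "of_nat (2 * Suc (Suc m) + 1) * u" "of_nat (2 * m + 1) * u"]
      by (simp add: algebra_simps add_divide_distrib)
    then have "cos (of_nat (2 * Suc (Suc m) + 1) * u)
        = 2 * (cos u * poly Q ((cos u)\<^sup>2)) * (2 * (cos u)\<^sup>2 - 1) - cos u * poly P ((cos u)\<^sup>2)"
      unfolding P(1) Q(1) cos_double_cos by (simp add: eq_diff_eq)
    then show ?thesis
      by (simp add: algebra_simps)
  qed
  moreover have "poly ([:- 2, 4:] * Q - P) 0 = (- 1) ^ Suc (Suc m) * of_nat (2 * Suc (Suc m) + 1)"
    by (simp add: P(2) Q(2) algebra_simps)
  ultimately show ?case by blast
qed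

section \<open>The hypergeometric function and the cosine\<close>

definition hypF_fps :: "complex \<Rightarrow> complex fps" where
  "hypF_fps a = fps_hypergeo [1/2 - a, 1/2 + a] [1/2] 1"

lemma hypF_fps_rec:
  "of_nat (Suc k) * (of_nat k + 1/2) * fps_nth (hypF_fps a) (Suc k)
     = ((of_nat k + 1/2)\<^sup>2 - a\<^sup>2) * fps_nth (hypF_fps a) k"
proof -
  define q where "q = fps_nth (hypF_fps a) k"
  have "(of_nat (2 * k + 1) :: complex) \<noteq> 0" by (simp only: of_nat_eq_0_iff)
  then have nz: "(of_nat k + 1/2 :: complex) \<noteq> 0" by (simp add: field_simps)
  have "fps_nth (hypF_fps a) (Suc k) = (1/2 - a + of_nat k) * (1/2 + a + of_nat k) /
      (of_nat (Suc k) * (1/2 + of_nat k)) * q"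
    unfolding q_def hypF_fps_def fps_hypergeo_rec by simp
  moreover have "(of_nat (Suc k) * (1/2 + of_nat k) :: complex) \<noteq> 0"
    using nz by (simp add: add.commute del: of_nat_Suc)
  ultimately have "of_nat (Suc k) * (1/2 + of_nat k) * fps_nth (hypF_fps a) (Suc k)
      = (1/2 - a + of_nat k) * (1/2 + a + of_nat k) * q"
    by (simp del: of_nat_Suc)
  then show ?thesis unfolding q_def[symmetric]
    by (simp add: power2_eq_square algebra_simps)
qed

text \<open>
  The radius is in fact at least 1, but everything below takes place near \<open>0\<close>, so a crude geometric
  bound on the ratio of consecutive coefficients is enough.
\<close>

lemma hypF_fps_conv_radius_pos: "fps_conv_radius (hypF_fps a) > 0"
proof -
  define C where "C = 1 + 2 * (norm a)\<^sup>2"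
  have C: "C > 0" by (simp add: C_def add_pos_nonneg)
  have step: "norm (fps_nth (hypF_fps a) (Suc k)) \<le> C * norm (fps_nth (hypF_fps a) k)" for k
  proof -
    define w :: real where "w = real (Suc k) * (real k + 1/2)"
    have w_eq: "w = (real k + 1/2)\<^sup>2 + (real k + 1/2) / 2"
      by (simp add: w_def power2_eq_square field_simps)
    have w: "w \<ge> 1/2" "w \<ge> (real k + 1/2)\<^sup>2"
      unfolding w_eq by (auto simp: power2_eq_square field_simps)
    have "w * norm (fps_nth (hypF_fps a) (Suc k)) = norm (of_real w * fps_nth (hypF_fps a) (Suc k))"
      using w by (simp add: norm_mult)
    also have "of_real w * fps_nth (hypF_fps a) (Suc k) = ((of_nat k + 1/2)\<^sup>2 - a\<^sup>2) * fps_nth (hypF_fps a) k"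
      by (simp add: w_def flip: hypF_fps_rec)
    also have "norm \<dots> \<le> ((real k + 1/2)\<^sup>2 + (norm a)\<^sup>2) * norm (fps_nth (hypF_fps a) k)"
      unfolding norm_mult
    proof (rule mult_right_mono)
      have "norm ((complex_of_nat k + 1/2)\<^sup>2 - a\<^sup>2) \<le> (norm (complex_of_nat k + 1/2))\<^sup>2 + (norm a)\<^sup>2"
        by (metis norm_power norm_triangle_ineq4)
      also have "norm (complex_of_nat k + 1/2) = real k + 1/2"
      proof -
        have "complex_of_nat k + 1/2 = of_real (real k + 1/2)" by simp
        then show ?thesis by (simp only: norm_of_real)
      qed
      finally show "norm ((complex_of_nat k + 1/2)\<^sup>2 - a\<^sup>2) \<le> (real k + 1/2)\<^sup>2 + (norm a)\<^sup>2" .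
    qed simp
    also have "\<dots> \<le> (C * w) * norm (fps_nth (hypF_fps a) k)"
    proof (rule mult_right_mono)
      have "(norm a)\<^sup>2 * 1 \<le> (norm a)\<^sup>2 * (2 * w)"
        by (rule mult_left_mono) (use w in auto)
      then show "(real k + 1/2)\<^sup>2 + (norm a)\<^sup>2 \<le> C * w"
        using w(2) by (simp add: C_def algebra_simps)
    qed simp
    finally have "w * norm (fps_nth (hypF_fps a) (Suc k)) \<le> w * (C * norm (fps_nth (hypF_fps a) k))"
      by (simp only: mult_ac)
    then show ?thesis using w by (simp)
  qed
  have "summable (\<lambda>k. fps_nth (hypF_fps a) k * (of_real (1 / (2 * C))) ^ k)"
  proof (rule summable_ratio_test)
    fix k :: nat
    have "norm (fps_nth (hypF_fps a) (Suc k)) * (1 / (2 * C)) ^ Suc k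
        \<le> (C * norm (fps_nth (hypF_fps a) k)) * (1 / (2 * C)) ^ Suc k"
      by (rule mult_right_mono[OF step]) (use C in auto)
    also have "\<dots> = 1/2 * (norm (fps_nth (hypF_fps a) k) * (1 / (2 * C)) ^ k)"
      using C by (simp add: field_simps)
    finally show "norm (fps_nth (hypF_fps a) (Suc k) * (of_real (1 / (2 * C))) ^ Suc k)
        \<le> 1/2 * norm (fps_nth (hypF_fps a) k * (of_real (1 / (2 * C))) ^ k)"
      using C by (simp only: norm_mult norm_power norm_of_real) simp
  qed simp
  then have "conv_radius (fps_nth (hypF_fps a)) \<ge> norm (of_real (1 / (2 * C)) :: complex)"
    by (rule conv_radius_geI)
  moreover have "ereal (norm (of_real (1 / (2 * C)) :: complex)) > 0"
    using C by simp
  ultimately show ?thesis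
    unfolding fps_conv_radius_def by (rule less_le_trans[rotated])
qed

text \<open>
  Gauss's equation \<open>X (1 - X) F'' + (C - (A + B + 1) X) F' = A B F\<close> for \<open>A = 1/2 - a\<close>,
  \<open>B = 1/2 + a\<close> and \<open>C = 1/2\<close>.
\<close>

lemma hypF_fps_ode:
  "fps_X * (1 - fps_X) * fps_deriv (fps_deriv (hypF_fps a))
     + (fps_const (1/2) - fps_const 2 * fps_X) * fps_deriv (hypF_fps a)
     = fps_const (1/4 - a\<^sup>2) * hypF_fps a"
proof (rule fps_ext)
  fix k
  define c where "c = fps_nth (hypF_fps a)"
  have rec: "of_nat (Suc k) * (of_nat k + 1/2) * c (Suc k) = ((of_nat k + 1/2)\<^sup>2 - a\<^sup>2) * c k"
    unfolding c_def by (rule hypF_fps_rec)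
  have "fps_nth (fps_X * (1 - fps_X) * fps_deriv (fps_deriv (hypF_fps a))
     + (fps_const (1/2) - fps_const 2 * fps_X) * fps_deriv (hypF_fps a)) k
     = of_nat k * of_nat (Suc k) * c (Suc k) - of_nat k * (of_nat k - 1) * c k
       + 1/2 * of_nat (Suc k) * c (Suc k) - 2 * of_nat k * c k"
    unfolding c_def
    by (cases k; cases "k - 1")
       (simp_all add: algebra_simps mult.assoc[of fps_X] fps_numeral_nth)
  also have "\<dots> = of_nat (Suc k) * (of_nat k + 1/2) * c (Suc k) - (of_nat k * (of_nat k - 1) + 2 * of_nat k) * c k"
    by (simp add: algebra_simps)
  also have "\<dots> = (1/4 - a\<^sup>2) * c k"
    unfolding rec by (simp add: algebra_simps power2_eq_square)
  finally show "fps_nth (fps_X * (1 - fps_X) * fps_deriv (fps_deriv (hypF_fps a))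
     + (fps_const (1/2) - fps_const 2 * fps_X) * fps_deriv (hypF_fps a)) k
     = fps_nth (fps_const (1/4 - a\<^sup>2) * hypF_fps a) k"
    by (simp add: c_def)
qed

text \<open>
  The combinations \<open>b E cos - E' sin\<close> and \<open>b E sin + E' cos\<close> (trigonometric functions at \<open>b u\<close>)
  are constant along solutions of \<open>E'' = - b\<^sup>2 E\<close>, and \<open>b E\<close> is recovered from them by a rotation.
\<close>

lemma second_order_ode_eq_cos:
  fixes E E' :: "complex \<Rightarrow> complex"
  assumes S: "convex S" "0 \<in> S" and b: "b \<noteq> 0"
    and E: "\<And>u. u \<in> S \<Longrightarrow> (E has_field_derivative E' u) (at u)"
    and E': "\<And>u. u \<in> S \<Longrightarrow> (E' has_field_derivative - (b\<^sup>2 * E u)) (at u)"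
    and init: "E 0 = 1" "E' 0 = 0" and u: "u \<in> S"
  shows "E u = cos (b * u)"
proof -
  define P where "P = (\<lambda>u. b * E u * cos (b * u) - E' u * sin (b * u))"
  define Q where "Q = (\<lambda>u. b * E u * sin (b * u) + E' u * cos (b * u))"
  have "\<exists>c. \<forall>v\<in>S. P v = c"
  proof (rule has_field_derivative_zero_constant[OF S(1)])
    fix v assume "v \<in> S"
    then have "(P has_field_derivative 0) (at v)"
      unfolding P_def
      by (auto intro!: derivative_eq_intros E E' simp: power2_eq_square algebra_simps)
    then show "(P has_field_derivative 0) (at v within S)"
      by (rule has_field_derivative_at_within)
  qed
  moreover have "\<exists>c. \<forall>v\<in>S. Q v = c"
  proof (rule has_field_derivative_zero_constant[OF S(1)])
    fix v assume "v \<in> S"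
    then have "(Q has_field_derivative 0) (at v)"
      unfolding Q_def
      by (auto intro!: derivative_eq_intros E E' simp: power2_eq_square algebra_simps)
    then show "(Q has_field_derivative 0) (at v within S)"
      by (rule has_field_derivative_at_within)
  qed
  ultimately have "P u = P 0" "Q u = Q 0"
    using S(2) u by metis+
  then have PQ: "P u = b" "Q u = 0"
    by (simp_all add: P_def Q_def init)
  have "P u * cos (b * u) + Q u * sin (b * u) = b * E u * ((sin (b * u))\<^sup>2 + (cos (b * u))\<^sup>2)"
    by (simp only: P_def Q_def power2_eq_square distrib_left left_diff_distrib distrib_right)
      (simp only: mult_ac, simp)
  then have "b * E u = P u * cos (b * u) + Q u * sin (b * u)"
    by simp
  then show ?thesis using b PQ by simp
qed

lemma hypF_has_field_derivative:
  assumes "norm z < fps_conv_radius (hypF_fps a)"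
  shows "(hypF a has_field_derivative eval_fps (fps_deriv (hypF_fps a)) z) (at z)"
proof -
  have "hypF a = eval_fps (hypF_fps a)"
    by (simp add: hypF_def hypF_fps_def fun_eq_iff)
  then show ?thesis using has_field_derivative_eval_fps[OF assms] by simp
qed

lemma hypF_ode:
  assumes z: "norm z < fps_conv_radius (hypF_fps a)"
  defines "F' \<equiv> eval_fps (fps_deriv (hypF_fps a))"
    and "F'' \<equiv> eval_fps (fps_deriv (fps_deriv (hypF_fps a)))"
  shows "z * (1 - z) * F'' z + (1/2 - 2 * z) * F' z = (1/4 - a\<^sup>2) * hypF a z"
proof -
  note r1 = less_le_trans[OF z fps_conv_radius_deriv]
  note r2 = less_le_trans[OF r1 fps_conv_radius_deriv]
  have prod: "norm z < fps_conv_radius (f * g)"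
    if "norm z < fps_conv_radius f" "norm z < fps_conv_radius g" for f g :: "complex fps"
    using that by (intro less_le_trans[OF _ fps_conv_radius_mult]) simp
  have diff: "norm z < fps_conv_radius (f - g)"
    if "norm z < fps_conv_radius f" "norm z < fps_conv_radius g" for f g :: "complex fps"
    using that by (intro less_le_trans[OF _ fps_conv_radius_diff]) simp
  have "eval_fps (fps_X * (1 - fps_X) * fps_deriv (fps_deriv (hypF_fps a))
     + (fps_const (1/2) - fps_const 2 * fps_X) * fps_deriv (hypF_fps a)) z
     = z * (1 - z) * F'' z + (1/2 - 2 * z) * F' z"
    unfolding F'_def F''_def
    by (simp add: eval_fps_add eval_fps_mult eval_fps_diff prod diff r1 r2)
  moreover have "eval_fps (fps_const (1/4 - a\<^sup>2) * hypF_fps a) z = (1/4 - a\<^sup>2) * hypF a z"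
    using z by (simp add: eval_fps_mult hypF_def hypF_fps_def)
  ultimately show ?thesis unfolding hypF_fps_ode by simp
qed

text \<open>
  Under the substitution \<open>z = sin\<^sup>2 u\<close>, Gauss's equation for \<open>F\<^sub>a\<close> becomes \<open>E'' = - (2a)\<^sup>2 E\<close> for
  \<open>E u = F\<^sub>a (sin\<^sup>2 u) cos u\<close>, and \<open>E 0 = 1\<close>, \<open>E' 0 = 0\<close>.
\<close>

lemma hypF_sin_squared:
  assumes "a \<noteq> 0"
  shows "\<forall>\<^sub>F u in nhds 0. hypF a ((sin u)\<^sup>2) * cos u = cos (2 * a * u)"
proof -
  define F' where "F' = eval_fps (fps_deriv (hypF_fps a))"
  define F'' where "F'' = eval_fps (fps_deriv (fps_deriv (hypF_fps a)))"
  obtain R :: real where R: "R > 0" "ereal R < fps_conv_radius (hypF_fps a)"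
    using ereal_dense2[OF hypF_fps_conv_radius_pos[of a]] by auto
  have "((\<lambda>u::complex. (sin u)\<^sup>2) \<longlongrightarrow> (sin 0)\<^sup>2) (nhds 0)"
    by (intro tendsto_intros filterlim_ident)
  then have "((\<lambda>u::complex. norm ((sin u)\<^sup>2)) \<longlongrightarrow> 0) (nhds 0)"
    by (intro tendsto_norm_zero) simp
  then have "\<forall>\<^sub>F u::complex in nhds 0. norm ((sin u)\<^sup>2) < R"
    by (rule order_tendstoD) (rule R)
  then obtain r where r: "r > 0" "\<And>u::complex. dist u 0 < r \<Longrightarrow> norm ((sin u)\<^sup>2) < R"
    unfolding eventually_nhds_metric by blast
  have conv: "norm ((sin u)\<^sup>2) < fps_conv_radius (hypF_fps a)" if "u \<in> ball 0 r" for u :: complex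
  proof -
    have "ereal (norm ((sin u)\<^sup>2)) < ereal R"
      using r(2)[of u] that by (simp add: dist_commute)
    then show ?thesis using R(2) by (rule less_trans)
  qed
  define E where "E = (\<lambda>u. hypF a ((sin u)\<^sup>2) * cos u)"
  define E' where "E' = (\<lambda>u. F' ((sin u)\<^sup>2) * 2 * sin u * (cos u)\<^sup>2 - hypF a ((sin u)\<^sup>2) * sin u)"
  have "E u = cos ((2 * a) * u)" if u: "u \<in> ball 0 r" for u
  proof (rule second_order_ode_eq_cos[where S = "ball 0 r" and E' = E'])
    fix v :: complex assume v: "v \<in> ball 0 r"
    note c0 = conv[OF v]
    note c1 = less_le_trans[OF c0 fps_conv_radius_deriv]
    have dF: "((\<lambda>u. hypF a ((sin u)\<^sup>2)) has_field_derivative F' ((sin v)\<^sup>2) * (2 * sin v * cos v)) (at v)"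
      unfolding F'_def
      by (rule DERIV_chain2[where f = "hypF a" and g = "\<lambda>u. (sin u)\<^sup>2" and x = v, OF hypF_has_field_derivative[OF c0]]) (auto intro!: derivative_eq_intros)
    have dF': "((\<lambda>u. F' ((sin u)\<^sup>2)) has_field_derivative F'' ((sin v)\<^sup>2) * (2 * sin v * cos v)) (at v)"
      unfolding F'_def F''_def
      by (rule DERIV_chain2[where f = "eval_fps (fps_deriv (hypF_fps a))" and g = "\<lambda>u. (sin u)\<^sup>2" and x = v, OF has_field_derivative_eval_fps[OF c1]]) (auto intro!: derivative_eq_intros)
    show "(E has_field_derivative E' v) (at v)"
      unfolding E_def E'_def
      by (rule dF derivative_eq_intros refl)+ (simp add: power2_eq_square algebra_simps)
    have cos2: "(cos v)\<^sup>2 = 1 - (sin v)\<^sup>2"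
      by (simp add: cos_squared_eq)
    define z where "z = (sin v)\<^sup>2"
    have ode: "z * (1 - z) * F'' z + (1/2 - 2 * z) * F' z = (1/4 - a\<^sup>2) * hypF a z"
      unfolding F'_def F''_def z_def by (rule hypF_ode[OF c0])
    have "(E' has_field_derivative
        F'' z * (2 * sin v * cos v) * 2 * sin v * (cos v)\<^sup>2
        + F' z * 2 * (cos v * (cos v)\<^sup>2 - sin v * (2 * cos v * sin v))
        - F' z * (2 * sin v * cos v) * sin v - hypF a z * cos v) (at v)"
      unfolding E'_def z_def
      by (rule dF dF' derivative_eq_intros refl)+ (simp add: power2_eq_square algebra_simps)
    also have "F'' z * (2 * sin v * cos v) * 2 * sin v * (cos v)\<^sup>2
        + F' z * 2 * (cos v * (cos v)\<^sup>2 - sin v * (2 * cos v * sin v))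
        - F' z * (2 * sin v * cos v) * sin v - hypF a z * cos v
        = cos v * (4 * (z * (1 - z) * F'' z + (1/2 - 2 * z) * F' z) - hypF a z)"
    proof -
      have s: "sin v * sin v = z" "sin v * (sin v * x) = z * x" for x
        by (simp_all add: z_def power2_eq_square mult.assoc)
      show ?thesis unfolding cos2 z_def[symmetric]
        by (simp add: algebra_simps s)
    qed
    also have "\<dots> = - ((2 * a)\<^sup>2 * E v)"
      unfolding ode by (simp add: E_def z_def power2_eq_square algebra_simps)
    finally show "(E' has_field_derivative - ((2 * a)\<^sup>2 * E v)) (at v)" .
  next
    show "E 0 = 1"
      by (simp add: E_def hypF_def eval_fps_at_0)
  qed (use assms r(1) u in \<open>auto simp: E'_def\<close>)
  then show ?thesis
    unfolding eventually_nhds_metric E_def using r(1)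
    by (intro exI[of _ r]) (auto simp: dist_commute)
qed

section \<open>Meromorphic and analytic functions\<close>

lemma poly_meromorphic_on:
  assumes "f meromorphic_on A"
  shows "(\<lambda>z. poly p (f z)) meromorphic_on A"
  unfolding poly_altdef by (intro meromorphic_intros assms)

text \<open>
  The identity theorem: this transports an identity between meromorphic functions from a
  neighbourhood of one point to a neighbourhood of any other.
\<close>

lemma meromorphic_eventually_eq_0:
  assumes mero: "f meromorphic_on UNIV" and ev: "\<forall>\<^sub>F w in at z0. f w = 0"
  shows "\<forall>\<^sub>F w in at z. f w = 0"
proof -
  have nice: "remove_sings f nicely_meromorphic_on UNIV"
    by (rule remove_sings_nicely_meromorphic[OF mero])
  have iso: "isolated_singularity_at f x" for x
    using mero by (rule meromorphic_on_isolated_singularity[OF meromorphic_on_subset]) auto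
  have "\<forall>\<^sub>F w in at z0. remove_sings f w = 0"
    using eventually_remove_sings_eq_at[OF iso] ev by eventually_elim simp
  then have "\<exists>\<^sub>F w in at z0. remove_sings f w = 0"
    by (rule eventually_frequently[rotated]) simp
  then have "remove_sings f w = 0" for w
    by (rule frequently_eq_meromorphic_imp_constant[OF _ nice]) auto
  with eventually_remove_sings_eq_at[OF iso[of z]] show ?thesis
    by simp
qed

text \<open>
  The compact set is the closed period parallelogram: subtracting the integer parts of the
  coordinates with respect to the basis of periods moves every point into it.
\<close>

lemma doubly_periodic_range_eq:
  fixes f :: "complex \<Rightarrow> 'a"
  assumes ind: "independent {w1, w2}" "w1 \<noteq> w2"
    and per: "\<And>z. f (z + w1) = f z" "\<And>z. f (z + w2) = f z"
  obtains K where "compact K" "range f = f ` K"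
proof
  define L where "L = (\<lambda>(s, t). s *\<^sub>R w1 + t *\<^sub>R w2 :: complex)"
  define K where "K = L ` ({0..1} \<times> {0..1})"
  have "continuous_on ({0..1} \<times> {0..1}) L"
    unfolding L_def by (auto intro!: continuous_intros simp: case_prod_unfold)
  then show "compact K"
    unfolding K_def by (intro compact_continuous_image compact_Times) auto
  have per_int: "f (z + of_int k * w) = f z" if w: "\<And>z. f (z + w) = f z" for z w and k :: int
  proof (induction k arbitrary: z rule: int_induct[where k = 0])
    case (step1 i)
    show ?case using step1.IH[of z] w[of "z + of_int i * w"] by (simp add: algebra_simps)
  next
    case (step2 i)
    show ?case using step2.IH[of z] w[of "z + of_int (i - 1) * w"] by (simp add: algebra_simps)
  qed simp
  have "dim (UNIV :: complex set) = 2" by simp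
  then have "UNIV \<subseteq> span {w1, w2}"
    using ind by (subst card_eq_dim[symmetric]) auto
  have "f z \<in> f ` K" for z
  proof -
    have "z \<in> span {w1, w2}" using \<open>UNIV \<subseteq> span {w1, w2}\<close> by blast
    then obtain s t where z: "z = s *\<^sub>R w1 + t *\<^sub>R w2"
      unfolding span_insert span_singleton by (auto simp: algebra_simps)
    have "z = frac s *\<^sub>R w1 + frac t *\<^sub>R w2 + of_int \<lfloor>s\<rfloor> * w1 + of_int \<lfloor>t\<rfloor> * w2"
      by (simp add: z frac_def scaleR_conv_of_real algebra_simps)
    then have "f z = f (frac s *\<^sub>R w1 + frac t *\<^sub>R w2)"
      using per_int[OF per(1)] per_int[OF per(2)] by simp
    moreover have "frac s *\<^sub>R w1 + frac t *\<^sub>R w2 \<in> K"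
      unfolding K_def L_def
      by (rule image_eqI[of _ _ "(frac s, frac t)"]) (auto simp: frac_ge_0 less_imp_le[OF frac_lt_1])
    ultimately show ?thesis by blast
  qed
  then show "range f = f ` K" by blast
qed

text \<open>
  If no point of analyticity were a zero, then \<open>1/f\<close> would be entire, and bounded because its values
  on a period parallelogram are all its values; Liouville's theorem would make it constant.
\<close>

lemma elliptic_has_zero:
  assumes nice: "f nicely_meromorphic_on UNIV"
    and ind: "independent {w1, w2}" "w1 \<noteq> w2"
    and per: "\<And>z. f (z + w1) = f z" "\<And>z. f (z + w2) = f z"
    and nonconst: "\<not> f constant_on UNIV"
  obtains z where "f analytic_on {z}" "f z = 0"
proof (rule ccontr)
  assume no: "\<not> thesis"
  have inv_nice: "(\<lambda>z. inverse (f z)) nicely_meromorphic_on UNIV"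
    by (rule nicely_meromorphic_on_inverse[OF nice])
  have "\<not> is_pole (\<lambda>z. inverse (f z)) z" for z
  proof
    assume pole: "is_pole (\<lambda>z. inverse (f z)) z"
    then have "inverse (f z) = 0"
      by (rule is_pole_zero_at_nicely_mero[OF inv_nice]) simp
    then have "f z = 0" by simp
    moreover have "\<not> is_pole f z"
    proof
      assume "is_pole f z"
      then have "((\<lambda>z. inverse (f z)) \<longlongrightarrow> 0) (at z)"
        unfolding is_pole_def by (rule filterlim_compose[OF tendsto_inverse_0])
      with pole show False
        unfolding is_pole_def by (rule not_tendsto_and_filterlim_at_infinity[OF at_neq_bot, rotated])
    qed
    then have "f analytic_on {z}"
      using nicely_meromorphic_on_imp_analytic_at[OF nice] by simp
    ultimately show False using no that by blast
  qed
  then have "(\<lambda>z. inverse (f z)) analytic_on UNIV"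
    using nicely_meromorphic_without_singularities[OF inv_nice] by simp
  then have holo: "(\<lambda>z. inverse (f z)) holomorphic_on UNIV"
    by (rule analytic_imp_holomorphic)
  obtain K where K: "compact K" "range (\<lambda>z. inverse (f z)) = (\<lambda>z. inverse (f z)) ` K"
    using doubly_periodic_range_eq[OF ind, of "\<lambda>z. inverse (f z)"] per by auto
  have "bounded (range (\<lambda>z. inverse (f z)))"
    unfolding K(2)
    by (intro compact_imp_bounded compact_continuous_image K(1))
       (rule continuous_on_subset[OF holomorphic_on_imp_continuous_on[OF holo]], simp)
  with holo have "(\<lambda>z. inverse (f z)) constant_on UNIV"
    by (rule Liouville_theorem)
  then obtain c where "\<And>z. inverse (f z) = c" unfolding constant_on_def by blast
  then have "f z = inverse c" for z by (metis inverse_inverse_eq)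
  with nonconst show False unfolding constant_on_def by blast
qed

lemma analytic_at_imp_eventually_analytic_at:
  assumes "f analytic_on {z0}"
  shows "\<forall>\<^sub>F z in nhds z0. f analytic_on {z}"
proof -
  obtain A where "open A" "z0 \<in> A" "f holomorphic_on A"
    using assms unfolding analytic_at by blast
  then show ?thesis
    unfolding eventually_nhds by (metis analytic_at)
qed

lemma analytic_at_imp_tendsto_nhds:
  assumes "f analytic_on {z}"
  shows "(f \<longlongrightarrow> f z) (nhds z)"
  using analytic_at_imp_isCont[OF assms] unfolding isCont_def tendsto_at_iff_tendsto_nhds .

text \<open>
  Write the equation as \<open>h\<^sup>2 = r(y)\<close>. Differentiating gives \<open>2 h h' = r'(y) y'\<close>, where
  \<open>h' = k y'\<close> with \<open>k = 2\<alpha> y'' + q'(y)\<close>. Cancelling \<open>y'\<close>, which is legitimate by continuity,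
  leaves \<open>2 h k = r'(y)\<close>. At a point where \<open>r(y) = 0\<close> also \<open>h = 0\<close>, and therefore \<open>r'(y) = 0\<close>.
  So \<open>y\<close> can reach multiple roots of \<open>r\<close> but no simple one.
\<close>

lemma simple_root_omitted_by_ode_solution:
  fixes q r :: "complex poly"
  assumes y: "y analytic_on {z0}" and nonconst: "\<exists>\<^sub>F z in at z0. deriv y z \<noteq> 0"
    and ode: "\<forall>\<^sub>F z in at z0. (\<alpha> * (deriv y z)\<^sup>2 + poly q (y z))\<^sup>2 = poly r (y z)"
    and root: "poly r (y z0) = 0"
  shows "poly (pderiv r) (y z0) = 0"
proof -
  define h where "h = (\<lambda>z. \<alpha> * (deriv y z)\<^sup>2 + poly q (y z))"
  define k where "k = (\<lambda>z. 2 * \<alpha> * deriv (deriv y) z + poly (pderiv q) (y z))"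
  define F where "F = (\<lambda>z. 2 * h z * k z - poly (pderiv r) (y z))"
  have y': "deriv y analytic_on {z0}" and y'': "deriv (deriv y) analytic_on {z0}"
    using y by (simp_all add: analytic_deriv)
  have poly_ana: "(\<lambda>z. poly p (y z)) analytic_on {z0}" for p
    unfolding poly_altdef by (intro analytic_intros y)
  have h_ana: "h analytic_on {z0}" and k_ana: "k analytic_on {z0}"
    unfolding h_def k_def by (intro analytic_intros y' y'' poly_ana)+
  have F_ana: "F analytic_on {z0}"
    unfolding F_def by (intro analytic_intros h_ana k_ana poly_ana)
  have cont: "(f \<longlongrightarrow> f z0) (at z0)" if "f analytic_on {z0}" for f :: "complex \<Rightarrow> complex"
    using analytic_at_imp_isCont[OF that] by (rule isContD)
  have ev_eq: "\<forall>\<^sub>F z in nhds z0. (h z)\<^sup>2 = poly r (y z)"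
  proof -
    have "(\<lambda>z. (h z)\<^sup>2 - poly r (y z)) \<midarrow>z0\<rightarrow> (h z0)\<^sup>2 - poly r (y z0)"
      by (intro tendsto_intros cont h_ana poly_ana)
    moreover have ev0: "\<forall>\<^sub>F z in at z0. (h z)\<^sup>2 - poly r (y z) = 0"
      using ode by (simp add: h_def)
    ultimately have "(\<lambda>z. 0) \<midarrow>z0\<rightarrow> (h z0)\<^sup>2 - poly r (y z0)"
      using tendsto_cong[OF ev0] by blast
    then have "(h z0)\<^sup>2 - poly r (y z0) = 0"
      using tendsto_unique[OF at_neq_bot _ tendsto_const] by blast
    with ev0 show ?thesis
      by (simp add: eventually_nhds_conv_at)
  qed
  have ev_eq2: "\<forall>\<^sub>F z in nhds z0. \<forall>\<^sub>F w in nhds z. (h w)\<^sup>2 = poly r (y w)"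
    using ev_eq by (subst eventually_eventually)
  have "\<forall>\<^sub>F z in nhds z0. deriv y z * F z = 0"
    using ev_eq2 analytic_at_imp_eventually_analytic_at[OF y]
      analytic_at_imp_eventually_analytic_at[OF y']
  proof eventually_elim
    case (elim z)
    have dy: "(y has_field_derivative deriv y z) (at z)"
      and dy': "(deriv y has_field_derivative deriv (deriv y) z) (at z)"
      by (rule analytic_derivI[OF elim(2)], rule analytic_derivI[OF elim(3)])
    have dp: "((\<lambda>z. poly p (y z)) has_field_derivative poly (pderiv p) (y z) * deriv y z) (at z)" for p
      by (rule DERIV_chain2[OF poly_DERIV dy])
    have "((\<lambda>z. (h z)\<^sup>2) has_field_derivative 2 * h z * (k z * deriv y z)) (at z)"
      unfolding h_def k_def
      by (rule dp dy' derivative_eq_intros refl)+ (simp add: algebra_simps)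
    moreover have "((\<lambda>z. (h z)\<^sup>2) has_field_derivative poly (pderiv r) (y z) * deriv y z) (at z)"
      using dp[of r] DERIV_cong_ev[OF refl elim(1) refl] by simp
    ultimately have "2 * h z * (k z * deriv y z) = poly (pderiv r) (y z) * deriv y z"
      by (rule DERIV_unique)
    then show ?case by (simp add: F_def algebra_simps)
  qed
  then have "\<forall>\<^sub>F z in at z0. deriv y z * F z = 0"
    by (simp add: eventually_nhds_conv_at)
  from frequently_eventually_frequently[OF nonconst this] have "\<exists>\<^sub>F z in at z0. F z = 0"
    by (rule frequently_elim1) auto
  then have "F z0 = 0"
    using tendsto_imp_eventually_ne[OF cont[OF F_ana], of 0] by (auto simp: frequently_def)
  moreover have "h z0 = 0"
    using eventually_nhds_x_imp_x[OF ev_eq] root by simp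
  ultimately show ?thesis by (simp add: F_def)
qed

section \<open>The differential equations of the amplitude\<close>

text \<open>
  On a disc around \<open>0\<close> the integrand has a primitive \<open>G\<close>, so the defining relation reads
  \<open>G (\<phi> t) - G 0 = t\<close>; this is its derivative.
\<close>

lemma local_inverse_deriv:
  assumes "is_local_inverse \<kappa> a \<phi>"
  shows "\<forall>\<^sub>F t in nhds 0. hypF a ((of_real \<kappa> * sin (\<phi> t))\<^sup>2) * deriv \<phi> t = 1"
proof -
  have ana: "\<phi> analytic_on {0}" and \<phi>0: "\<phi> 0 = 0"
    and int: "\<forall>\<^sub>F t in nhds 0. ((\<lambda>\<theta>. hypF a ((of_real \<kappa>)\<^sup>2 * (sin \<theta>)\<^sup>2)) has_contour_integral t)
      (linepath 0 (\<phi> t))"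
    using assms unfolding is_local_inverse_def by auto
  define f where "f = (\<lambda>\<theta>. hypF a ((of_real \<kappa> * sin \<theta>)\<^sup>2))"
  have f_alt: "(\<lambda>\<theta>. hypF a ((of_real \<kappa>)\<^sup>2 * (sin \<theta>)\<^sup>2)) = f"
    by (simp add: f_def power_mult_distrib)
  have "(\<lambda>\<theta>. eval_fps (hypF_fps a) ((of_real \<kappa> * sin \<theta>)\<^sup>2)) analytic_on {0}"
    by (intro analytic_intros) (simp add: hypF_fps_conv_radius_pos zero_ereal_def[symmetric])
  then have "f analytic_on {0}"
    by (simp add: f_def hypF_def hypF_fps_def)
  then obtain r where r: "r > 0" "f holomorphic_on ball 0 r"
    unfolding analytic_on_def by auto
  obtain G where G: "\<And>x. x \<in> ball 0 r \<Longrightarrow> (G has_field_derivative f x) (at x)"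
    using holomorphic_convex_primitive'[OF convex_ball open_ball r(2)]
    by (metis at_within_open open_ball)
  have small: "\<forall>\<^sub>F t in nhds 0. \<phi> t \<in> ball 0 r"
  proof -
    have "(\<phi> \<longlongrightarrow> 0) (nhds 0)"
      using analytic_at_imp_tendsto_nhds[OF ana] by (simp add: \<phi>0)
    then show ?thesis
      by (rule topological_tendstoD) (use r in auto)
  qed
  have inv: "\<forall>\<^sub>F t in nhds 0. G (\<phi> t) - G 0 = t"
    using int small
  proof eventually_elim
    case (elim t)
    have "(f has_contour_integral G (pathfinish (linepath 0 (\<phi> t))) - G (pathstart (linepath 0 (\<phi> t))))
        (linepath 0 (\<phi> t))"
    proof (rule contour_integral_primitive[where S = "ball 0 r"])
      show "path_image (linepath 0 (\<phi> t)) \<subseteq> ball 0 r"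
        using elim(2) r(1) by (simp add: closed_segment_subset)
      show "(G has_field_derivative f x) (at x within ball 0 r)" if "x \<in> ball 0 r" for x
        by (rule has_field_derivative_at_within[OF G[OF that]])
    qed (rule valid_path_linepath)
    then show ?case
      using elim(1) has_contour_integral_unique by (fastforce simp: f_alt)
  qed
  have "\<forall>\<^sub>F t in nhds 0. \<forall>\<^sub>F w in nhds t. G (\<phi> w) - G 0 = w"
    using inv by (subst eventually_eventually)
  then show ?thesis
    using small analytic_at_imp_eventually_analytic_at[OF ana]
  proof eventually_elim
    case (elim t)
    have "((\<lambda>w. G (\<phi> w) - G 0) has_field_derivative f (\<phi> t) * deriv \<phi> t - 0) (at t)"
      by (intro DERIV_diff DERIV_const DERIV_chain2[where f = G and g = \<phi> and x = t, OF G[OF elim(2)]] analytic_derivI elim(3))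
    moreover have "((\<lambda>w. G (\<phi> w) - G 0) has_field_derivative 1) (at t)"
      using DERIV_cong_ev[OF refl elim(1) refl] DERIV_ident by blast
    ultimately have "f (\<phi> t) * deriv \<phi> t - 0 = 1"
      by (rule DERIV_unique)
    then show ?case by (simp add: f_def)
  qed
qed

text \<open>
  Differentiating \<open>sin \<psi> = \<kappa> sin \<phi>\<close> gives \<open>\<psi>' cos \<psi> = \<kappa> \<phi>' cos \<phi>\<close>, while
  \<open>F\<^sub>a (sin\<^sup>2 \<psi>) \<phi>' = 1\<close> and the closed form of \<open>F\<^sub>a\<close> give \<open>\<phi>' cos (2a\<psi>) = cos \<psi>\<close>. Near \<open>0\<close>
  the factor \<open>cos \<psi>\<close> can be cancelled.
\<close>

lemma amplitude_psi_deriv: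
  assumes \<phi>: "is_local_inverse \<kappa> a \<phi>" and \<psi>: "is_amplitude_psi \<kappa> \<phi> \<psi>" and a: "a \<noteq> 0"
  shows "\<forall>\<^sub>F t in nhds 0. deriv \<psi> t * cos (2 * a * \<psi> t) = of_real \<kappa> * cos (\<phi> t)"
proof -
  have \<phi>_ana: "\<phi> analytic_on {0}" using \<phi> unfolding is_local_inverse_def by auto
  have \<psi>_ana: "\<psi> analytic_on {0}" and \<psi>0: "\<psi> 0 = 0"
    and sin_eq: "\<forall>\<^sub>F t in nhds 0. sin (\<psi> t) = of_real \<kappa> * sin (\<phi> t)"
    using \<psi> unfolding is_amplitude_psi_def by auto
  have lim: "(\<psi> \<longlongrightarrow> 0) (nhds 0)"
    using analytic_at_imp_tendsto_nhds[OF \<psi>_ana] by (simp add: \<psi>0)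
  have "((\<lambda>t. cos (\<psi> t)) \<longlongrightarrow> cos 0) (nhds 0)"
    by (intro tendsto_intros lim)
  then have cos_nz: "\<forall>\<^sub>F t in nhds 0. cos (\<psi> t) \<noteq> 0"
    by (rule tendsto_imp_eventually_ne) simp
  have hyp: "\<forall>\<^sub>F t in nhds 0. hypF a ((sin (\<psi> t))\<^sup>2) * cos (\<psi> t) = cos (2 * a * \<psi> t)"
    by (rule eventually_compose_filterlim[OF hypF_sin_squared[OF a] lim])
  have "\<forall>\<^sub>F t in nhds 0. \<forall>\<^sub>F w in nhds t. sin (\<psi> w) = of_real \<kappa> * sin (\<phi> w)"
    using sin_eq by (subst eventually_eventually)
  then show ?thesis
    using sin_eq cos_nz hyp local_inverse_deriv[OF \<phi>]
      analytic_at_imp_eventually_analytic_at[OF \<phi>_ana] analytic_at_imp_eventually_analytic_at[OF \<psi>_ana]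
  proof eventually_elim
    case (elim t)
    have "((\<lambda>w. sin (\<psi> w)) has_field_derivative cos (\<psi> t) * deriv \<psi> t) (at t)"
      by (rule DERIV_chain2[OF DERIV_sin analytic_derivI[OF elim(7)]])
    moreover have "((\<lambda>w. of_real \<kappa> * sin (\<phi> w)) has_field_derivative
        of_real \<kappa> * (cos (\<phi> t) * deriv \<phi> t)) (at t)"
      by (intro DERIV_cmult DERIV_chain2[OF DERIV_sin analytic_derivI[OF elim(6)]])
    then have "((\<lambda>w. sin (\<psi> w)) has_field_derivative of_real \<kappa> * (cos (\<phi> t) * deriv \<phi> t)) (at t)"
      using DERIV_cong_ev[OF refl elim(1) refl] by blast
    ultimately have chain: "cos (\<psi> t) * deriv \<psi> t = of_real \<kappa> * (cos (\<phi> t) * deriv \<phi> t)"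
      by (rule DERIV_unique)
    have "cos (2 * a * \<psi> t) * deriv \<phi> t = cos (\<psi> t) * (hypF a ((sin (\<psi> t))\<^sup>2) * deriv \<phi> t)"
      unfolding elim(4)[symmetric] by (simp only: mult_ac)
    also have "\<dots> = cos (\<psi> t)"
      unfolding elim(2) elim(5) by simp
    finally have \<phi>': "cos (2 * a * \<psi> t) * deriv \<phi> t = cos (\<psi> t)" .
    have "cos (\<psi> t) * (deriv \<psi> t * cos (2 * a * \<psi> t))
        = of_real \<kappa> * cos (\<phi> t) * (cos (2 * a * \<psi> t) * deriv \<phi> t)"
      using chain by (simp add: algebra_simps)
    then have "cos (\<psi> t) * (deriv \<psi> t * cos (2 * a * \<psi> t)) = cos (\<psi> t) * (of_real \<kappa> * cos (\<phi> t))"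
      unfolding \<phi>' by (simp add: mult_ac)
    then show ?case using elim(3) by simp
  qed
qed

text \<open>
  Both differential equations come from the equation for \<open>\<psi>'\<close>: it gives
  \<open>y' = - 4a\<kappa> sin (2a\<psi>) cos \<phi>\<close> and \<open>cos (2a\<psi>) g' = - 2\<kappa> sin (2\<psi>) cos \<phi>\<close>; in the squares,
  \<open>\<phi>\<close> enters only through \<open>\<kappa>\<^sup>2 cos\<^sup>2 \<phi> = \<kappa>\<^sup>2 - sin\<^sup>2 \<psi> = (g + l)/2\<close>. The second equation expresses
  \<open>y\<close> rationally through \<open>g\<close> and \<open>g'\<close>. The derivatives do not vanish near \<open>0\<close> away from \<open>0\<close>,
  because \<open>\<psi>' 0 = \<kappa>\<close> is not zero.
\<close>

lemma amplitude_germ: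
  fixes \<kappa> :: real and a l :: complex and \<phi> \<psi> y g :: "complex \<Rightarrow> complex"
  assumes \<phi>: "is_local_inverse \<kappa> a \<phi>" and \<psi>: "is_amplitude_psi \<kappa> \<phi> \<psi>" and a: "a \<noteq> 0"
    and \<kappa>: "\<kappa> \<noteq> 0"
    and y_def: "y = (\<lambda>t. (cos (2 * a * \<psi> t))\<^sup>2)" and g_def: "g = (\<lambda>t. cos (2 * \<psi> t))"
    and l_def: "l = 2 * (of_real \<kappa>)\<^sup>2 - 1"
  shows "y analytic_on {0}" and "g analytic_on {0}"
    and "\<forall>\<^sub>F t in nhds 0. (deriv y t)\<^sup>2 = 8 * a\<^sup>2 * (1 - y t) * (g t + l)"
    and "\<forall>\<^sub>F t in nhds 0. y t * (deriv g t)\<^sup>2 = 2 * (1 - (g t)\<^sup>2) * (g t + l)"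
    and "\<forall>\<^sub>F t in at 0. deriv y t \<noteq> 0"
    and "\<forall>\<^sub>F t in at 0. deriv g t \<noteq> 0"
proof -
  have \<phi>_ana: "\<phi> analytic_on {0}" and \<phi>0: "\<phi> 0 = 0"
    using \<phi> unfolding is_local_inverse_def by auto
  have \<psi>_ana: "\<psi> analytic_on {0}" and \<psi>0: "\<psi> 0 = 0"
    and sin_eq: "\<forall>\<^sub>F t in nhds 0. sin (\<psi> t) = of_real \<kappa> * sin (\<phi> t)"
    using \<psi> unfolding is_amplitude_psi_def by auto
  show "y analytic_on {0}" "g analytic_on {0}"
    unfolding y_def g_def by (intro analytic_intros \<psi>_ana)+
  note ode = amplitude_psi_deriv[OF \<phi> \<psi> a]
  have derivs: "\<forall>\<^sub>F t in nhds 0.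
      deriv y t = - (4 * a * of_real \<kappa> * sin (2 * a * \<psi> t) * cos (\<phi> t)) \<and>
      cos (2 * a * \<psi> t) * deriv g t = - (2 * of_real \<kappa> * sin (2 * \<psi> t) * cos (\<phi> t))"
    using ode analytic_at_imp_eventually_analytic_at[OF \<psi>_ana]
  proof eventually_elim
    case (elim t)
    have "(y has_field_derivative - (4 * a * sin (2 * a * \<psi> t) * (deriv \<psi> t * cos (2 * a * \<psi> t)))) (at t)"
      unfolding y_def by (rule analytic_derivI[OF elim(2)] derivative_eq_intros refl)+ (simp add: power2_eq_square)
    moreover have "(g has_field_derivative - (2 * sin (2 * \<psi> t) * deriv \<psi> t)) (at t)"
      unfolding g_def by (rule analytic_derivI[OF elim(2)] derivative_eq_intros refl)+ simp
    ultimately have dy: "deriv y t = - (4 * a * sin (2 * a * \<psi> t) * (deriv \<psi> t * cos (2 * a * \<psi> t)))"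
      and dg: "deriv g t = - (2 * sin (2 * \<psi> t) * deriv \<psi> t)"
      by (simp_all add: DERIV_imp_deriv)
    have "cos (2 * a * \<psi> t) * deriv g t = - (2 * sin (2 * \<psi> t) * (deriv \<psi> t * cos (2 * a * \<psi> t)))"
      unfolding dg by (simp add: mult_ac)
    then show ?case unfolding dy elim(1) by (simp add: mult_ac)
  qed
  have cos_sq: "\<forall>\<^sub>F t in nhds 0. 2 * (of_real \<kappa> * cos (\<phi> t))\<^sup>2 = g t + l"
    using sin_eq
  proof eventually_elim
    case (elim t)
    have "2 * (of_real \<kappa> * cos (\<phi> t))\<^sup>2 = 2 * (of_real \<kappa>)\<^sup>2 - 2 * (of_real \<kappa> * sin (\<phi> t))\<^sup>2"
      by (simp add: power_mult_distrib cos_squared_eq algebra_simps)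
    also have "\<dots> = g t + l"
      unfolding elim[symmetric] g_def l_def cos_double_sin by simp
    finally show ?case .
  qed
  show "\<forall>\<^sub>F t in nhds 0. (deriv y t)\<^sup>2 = 8 * a\<^sup>2 * (1 - y t) * (g t + l)"
    using derivs cos_sq
  proof eventually_elim
    case (elim t)
    have "(deriv y t)\<^sup>2 = 8 * a\<^sup>2 * (sin (2 * a * \<psi> t))\<^sup>2 * (2 * (of_real \<kappa> * cos (\<phi> t))\<^sup>2)"
      using elim(1) by (simp add: power_mult_distrib)
    then show ?case unfolding elim(2) by (simp add: y_def sin_squared_eq)
  qed
  show "\<forall>\<^sub>F t in nhds 0. y t * (deriv g t)\<^sup>2 = 2 * (1 - (g t)\<^sup>2) * (g t + l)"
    using derivs cos_sq
  proof eventually_elim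
    case (elim t)
    have "y t * (deriv g t)\<^sup>2 = (cos (2 * a * \<psi> t) * deriv g t)\<^sup>2"
      by (simp add: y_def power_mult_distrib)
    also have "\<dots> = 2 * (sin (2 * \<psi> t))\<^sup>2 * (2 * (of_real \<kappa> * cos (\<phi> t))\<^sup>2)"
      using elim(1) by (simp add: power_mult_distrib)
    finally show ?case unfolding elim(2) by (simp add: g_def sin_squared_eq)
  qed
  have "deriv \<psi> 0 = of_real \<kappa>"
    using eventually_nhds_x_imp_x[OF ode] by (simp add: \<phi>0 \<psi>0)
  then have \<psi>'0: "(\<psi> has_field_derivative of_real \<kappa>) (at 0)"
    using analytic_derivI[OF \<psi>_ana] by simp
  have sin_nz: "\<forall>\<^sub>F t in at 0. sin (b * \<psi> t) \<noteq> 0" if "b \<noteq> 0" for b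
  proof -
    have "((\<lambda>t. sin (b * \<psi> t)) has_field_derivative cos (b * \<psi> 0) * (b * of_real \<kappa>)) (at 0)"
      by (intro DERIV_chain2[OF DERIV_sin] DERIV_cmult \<psi>'0)
    then have "(\<lambda>t. sin (b * \<psi> t) / t) \<midarrow>0\<rightarrow> b * of_real \<kappa>"
      by (simp add: DERIV_def \<psi>0)
    then have "\<forall>\<^sub>F t in at 0. sin (b * \<psi> t) / t \<noteq> 0"
      by (rule tendsto_imp_eventually_ne) (use that \<kappa> in auto)
    then show ?thesis by eventually_elim auto
  qed
  have "(\<lambda>t. cos (\<phi> t)) \<midarrow>0\<rightarrow> cos (\<phi> 0)"
    using analytic_at_imp_isCont[OF \<phi>_ana] by (intro tendsto_intros) (simp add: isCont_def)
  then have cos_nz: "\<forall>\<^sub>F t in at 0. cos (\<phi> t) \<noteq> 0"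
    by (rule tendsto_imp_eventually_ne) (simp add: \<phi>0)
  note derivs_at = filter_leD[OF at_within_le_nhds derivs]
  have "2 * a \<noteq> 0" using a by simp
  from sin_nz[OF this] cos_nz derivs_at show "\<forall>\<^sub>F t in at 0. deriv y t \<noteq> 0"
  proof eventually_elim
    case (elim t)
    then have "deriv y t = - (4 * a * of_real \<kappa> * sin (2 * a * \<psi> t) * cos (\<phi> t))" by blast
    then show ?case using elim(1,2) a \<kappa> by simp
  qed
  have "(2 :: complex) \<noteq> 0" by simp
  from sin_nz[OF this] cos_nz derivs_at show "\<forall>\<^sub>F t in at 0. deriv g t \<noteq> 0"
  proof eventually_elim
    case (elim t)
    then have "cos (2 * a * \<psi> t) * deriv g t = - (2 * of_real \<kappa> * sin (2 * \<psi> t) * cos (\<phi> t))" by blast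
    moreover have "2 * of_real \<kappa> * sin (2 * \<psi> t) * cos (\<phi> t) \<noteq> 0" using elim(1,2) \<kappa> by simp
    ultimately show ?case by (metis mult_zero_right neg_equal_0_iff_equal)
  qed
qed

section \<open>The squares are not elliptic\<close>

text \<open>
  The hypotheses on \<open>f\<close> are those of an elliptic function without the normalisation of its values
  at the poles; in this form they pass to \<open>A + B f\<close>, as the reduction of \<open>c\<^sup>2\<close> and \<open>s\<^sup>2\<close>
  requires.
\<close>

lemma cos_psi_squared_not_elliptic:
  fixes \<kappa> :: real and n :: nat
  assumes \<phi>: "is_local_inverse \<kappa> a \<phi>" and \<psi>: "is_amplitude_psi \<kappa> \<phi> \<psi>" and \<kappa>: "\<kappa> \<noteq> 0"
    and n: "odd n" and a: "a = 1 / of_nat n"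
    and mero: "f meromorphic_on UNIV"
    and ind: "independent {w1, w2}" "w1 \<noteq> w2"
    and per: "\<And>z. f (z + w1) = f z" "\<And>z. f (z + w2) = f z"
  shows "\<not> (\<forall>\<^sub>F t in nhds 0. f t = (cos (\<psi> t))\<^sup>2)"
proof
  assume f_eq: "\<forall>\<^sub>F t in nhds 0. f t = (cos (\<psi> t))\<^sup>2"
  define l :: complex where "l = 2 * (of_real \<kappa>)\<^sup>2 - 1"
  define y where "y = (\<lambda>t. (cos (2 * a * \<psi> t))\<^sup>2)"
  define g where "g = (\<lambda>t. cos (2 * \<psi> t))"
  have a0: "a \<noteq> 0" using n a by (auto elim: oddE)
  note germ = amplitude_germ[OF \<phi> \<psi> a0 \<kappa> y_def g_def l_def]
  obtain m where m: "n = 2 * m + 1" using n by (auto elim: oddE)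
  obtain Q :: "complex poly" where Q: "\<And>u. cos (of_nat n * u) = cos u * poly Q ((cos u)\<^sup>2)"
    and "poly Q 0 = (- 1) ^ m * of_nat n"
    using cos_odd_multiple_eq_poly[of m] unfolding m by blast
  then have Q0: "poly Q 0 \<noteq> 0" using n by (auto elim: oddE)
  have g_sq: "(g t)\<^sup>2 = y t * (poly Q (y t))\<^sup>2" for t
  proof -
    have "of_nat n * a = 1" using a a0 by auto
    then have "2 * \<psi> t = of_nat n * (2 * a * \<psi> t)" by (simp add: mult_ac)
    then have "g t = cos (2 * a * \<psi> t) * poly Q (y t)"
      unfolding g_def y_def by (simp only: Q)
    then show ?thesis by (simp add: y_def power_mult_distrib)
  qed

  \<comment> \<open>\<open>G\<close> and \<open>Y\<close> continue the germs \<open>g\<close> and \<open>y\<close> to the plane; \<open>Y0\<close> solves \<open>y g'\<^sup>2 = 2 (1 - g\<^sup>2) (g + l)\<close> for \<open>y\<close>.\<close>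
  define G where "G = (\<lambda>z. 2 * f z - 1)"
  define Y0 where "Y0 = (\<lambda>z. 2 * (1 - (G z)\<^sup>2) * (G z + l) / (deriv G z)\<^sup>2)"
  define Y where "Y = remove_sings Y0"
  have G_mero: "G meromorphic_on UNIV"
    unfolding G_def by (intro meromorphic_intros mero)
  have Y0_mero: "Y0 meromorphic_on UNIV"
    unfolding Y0_def by (intro meromorphic_intros G_mero)
  have Y_nice: "Y nicely_meromorphic_on UNIV"
    unfolding Y_def by (rule remove_sings_nicely_meromorphic[OF Y0_mero])
  then have Y_mero: "Y meromorphic_on UNIV"
    by (simp add: nicely_meromorphic_on_def)
  have Y_per: "Y (z + w) = Y z" if w: "\<And>z. f (z + w) = f z" for z w
  proof -
    have G_w: "G (x + w) = G x" for x by (simp add: G_def w)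
    have "deriv G (x + w) = deriv G x" for x
      unfolding deriv_shift_0[of G "x + w"] deriv_shift_0[of G x]
      using G_w[of "x + _"] by (simp add: o_def add.assoc add.commute[of w])
    then have "Y0 (x + w) = Y0 x" for x by (simp add: Y0_def G_w)
    then have "(\<lambda>x. Y0 (z + w + x)) = (\<lambda>x. Y0 (z + x))"
      by (metis add.assoc add.commute)
    then show ?thesis
      unfolding Y_def remove_sings_shift_0[of Y0 "z + w"] remove_sings_shift_0[of Y0 z] by simp
  qed

  have G_eq: "\<forall>\<^sub>F t in nhds 0. G t = g t"
    using f_eq by eventually_elim (simp add: G_def g_def cos_double_cos)
  then have "\<forall>\<^sub>F t in nhds 0. \<forall>\<^sub>F w in nhds t. G w = g w"
    by (subst eventually_eventually)
  then have dG_eq: "\<forall>\<^sub>F t in nhds 0. deriv G t = deriv g t"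
    by eventually_elim (rule deriv_cong_ev, simp_all)
  have Y_eq: "\<forall>\<^sub>F t in nhds 0. Y t = y t"
  proof -
    have Y0_eq: "\<forall>\<^sub>F t in at 0. Y0 t = y t"
      using filter_leD[OF at_within_le_nhds G_eq] filter_leD[OF at_within_le_nhds dG_eq]
        filter_leD[OF at_within_le_nhds germ(4)] germ(6)
    proof eventually_elim
      case (elim t)
      then show ?case by (simp add: Y0_def divide_eq_eq)
    qed
    have "isolated_singularity_at Y0 0"
      using Y0_mero by (rule meromorphic_on_isolated_singularity[OF meromorphic_on_subset]) simp
    from eventually_remove_sings_eq_at[OF this] Y0_eq have "\<forall>\<^sub>F t in at 0. Y t = y t"
      by eventually_elim (simp add: Y_def)
    moreover have "Y 0 = y 0"
      unfolding Y_def remove_sings_cong[OF Y0_eq refl] by (rule remove_sings_at_analytic[OF germ(1)])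
    ultimately show ?thesis by (simp add: eventually_nhds_conv_at)
  qed
  then have "\<forall>\<^sub>F t in nhds 0. \<forall>\<^sub>F w in nhds t. Y w = y w"
    by (subst eventually_eventually)
  then have dY_eq: "\<forall>\<^sub>F t in nhds 0. deriv Y t = deriv y t"
    by eventually_elim (rule deriv_cong_ev, simp_all)

  \<comment> \<open>The equation with \<open>g\<close> eliminated reads \<open>(\<alpha> Y'\<^sup>2 + q(Y))\<^sup>2 = r(Y)\<close>.\<close>
  define q where "q = [:- l, l:]"
  define r where "r = [:1, - 1:]\<^sup>2 * [:0, 1:] * Q\<^sup>2"
  define \<alpha> where "\<alpha> = 1 / (8 * a\<^sup>2)"
  define Z where "Z = (\<lambda>z. (\<alpha> * (deriv Y z)\<^sup>2 + poly q (Y z))\<^sup>2 - poly r (Y z))"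
  have Z_mero: "Z meromorphic_on UNIV"
    unfolding Z_def by (intro meromorphic_intros poly_meromorphic_on Y_mero)
  have "\<forall>\<^sub>F t in nhds 0. Z t = 0"
    using Y_eq dY_eq germ(3)
  proof eventually_elim
    case (elim t)
    have "\<alpha> * (deriv Y t)\<^sup>2 + poly q (Y t) = (1 - y t) * g t"
      unfolding elim using a0 by (simp add: \<alpha>_def q_def algebra_simps)
    then have "(\<alpha> * (deriv Y t)\<^sup>2 + poly q (Y t))\<^sup>2 = (1 - y t)\<^sup>2 * (y t * (poly Q (y t))\<^sup>2)"
      by (simp add: power_mult_distrib g_sq)
    then show ?case by (simp add: Z_def r_def elim(1) mult_ac)
  qed
  then have "\<forall>\<^sub>F t in at 0. Z t = 0"
    by (rule filter_leD[OF at_within_le_nhds])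
  then have Z_zero: "\<forall>\<^sub>F t in at z. Z t = 0" for z
    by (rule meromorphic_eventually_eq_0[OF Z_mero])

  have dY_nz: "\<exists>\<^sub>F t in at z. deriv Y t \<noteq> 0" for z
  proof (rule ccontr)
    assume "\<not> ?thesis"
    then have "\<forall>\<^sub>F t in at z. deriv Y t = 0" by (simp add: frequently_def)
    then have "\<forall>\<^sub>F t in at 0. deriv Y t = 0"
      by (rule meromorphic_eventually_eq_0[rotated]) (intro meromorphic_intros Y_mero)
    with germ(5) filter_leD[OF at_within_le_nhds dY_eq] have "\<forall>\<^sub>F t in at (0::complex). False"
      by eventually_elim simp
    then show False by simp
  qed
  have "\<not> Y constant_on UNIV"
  proof
    assume "Y constant_on UNIV"
    then obtain c where "Y = (\<lambda>_. c)" unfolding constant_on_def by auto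
    then show False using dY_nz[of 0] by simp
  qed
  then obtain z0 where z0: "Y analytic_on {z0}" "Y z0 = 0"
    using elliptic_has_zero[OF Y_nice ind Y_per[OF per(1)] Y_per[OF per(2)]] by blast
  have "poly (pderiv r) (Y z0) = 0"
  proof (rule simple_root_omitted_by_ode_solution[OF z0(1) dY_nz])
    show "\<forall>\<^sub>F z in at z0. (\<alpha> * (deriv Y z)\<^sup>2 + poly q (Y z))\<^sup>2 = poly r (Y z)"
      using Z_zero[of z0] by (simp add: Z_def)
  qed (simp add: z0 r_def)
  \<comment> \<open>That is, \<open>0\<close> is a simple root of \<open>r\<close>.\<close>
  moreover have "poly (pderiv r) 0 = (poly Q 0)\<^sup>2"
    by (simp add: r_def pderiv_mult pderiv_pCons power2_eq_square)
  ultimately show False using Q0 z0(2) by simp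
qed

theorem theorem13:
  fixes \<kappa> :: real and m n :: nat and a :: complex
    and \<phi> \<psi> d c s :: "complex \<Rightarrow> complex"
  assumes "0 < \<kappa>" and "\<kappa> < 1"
    and "n = 2 * m + 1" and "a = 1 / of_nat n"
    and "is_local_inverse \<kappa> a \<phi>"
    and "is_amplitude_psi \<kappa> \<phi> \<psi>"
    and "d = (\<lambda>t. cos (\<psi> t))"
    and "c = (\<lambda>t. cos (\<phi> t))"
    and "s = (\<lambda>t. sin (\<phi> t))"
  shows "\<not> (\<exists>f. elliptic f \<and> (\<forall>\<^sub>F t in nhds 0. f t = (d t)\<^sup>2))
       \<and> \<not> (\<exists>f. elliptic f \<and> (\<forall>\<^sub>F t in nhds 0. f t = (c t)\<^sup>2))
       \<and> \<not> (\<exists>f. elliptic f \<and> (\<forall>\<^sub>F t in nhds 0. f t = (s t)\<^sup>2))"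
proof -
  have sin_eq: "\<forall>\<^sub>F t in nhds 0. sin (\<psi> t) = of_real \<kappa> * sin (\<phi> t)"
    using assms(6) unfolding is_amplitude_psi_def by auto
  have no_affine: False
    if f: "elliptic f" and eq: "\<forall>\<^sub>F t in nhds 0. (cos (\<psi> t))\<^sup>2 = A + B * f t" for f A B
  proof -
    obtain w1 w2 where w: "independent {w1, w2}" "w1 \<noteq> w2"
      and per: "\<And>z. f (z + w1) = f z" "\<And>z. f (z + w2) = f z" and mero: "f meromorphic_on UNIV"
      using f unfolding elliptic_def nicely_meromorphic_on_def by blast
    have "\<not> (\<forall>\<^sub>F t in nhds 0. A + B * f t = (cos (\<psi> t))\<^sup>2)"
    proof (rule cos_psi_squared_not_elliptic[OF assms(5,6) _ _ assms(4) _ w])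
      show "(\<lambda>t. A + B * f t) meromorphic_on UNIV"
        by (intro meromorphic_intros mero)
    qed (use assms(1,3) per in auto)
    with eq show False by (simp add: eq_commute)
  qed
  have "False" if "elliptic f" "\<forall>\<^sub>F t in nhds 0. f t = (d t)\<^sup>2" for f
    using no_affine[of f 0 1] that by (simp add: assms(7) eq_commute)
  moreover have "False" if f: "elliptic f" and ev: "\<forall>\<^sub>F t in nhds 0. f t = (c t)\<^sup>2" for f
  proof (rule no_affine[OF f])
    show "\<forall>\<^sub>F t in nhds 0. (cos (\<psi> t))\<^sup>2 = (1 - (of_real \<kappa>)\<^sup>2) + (of_real \<kappa>)\<^sup>2 * f t"
      using ev sin_eq
    proof eventually_elim
      case (elim t)
      show ?case
        unfolding elim(1) assms(8) cos_squared_eq elim(2) by (simp add: power_mult_distrib algebra_simps)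
    qed
  qed
  moreover have "False" if f: "elliptic f" and ev: "\<forall>\<^sub>F t in nhds 0. f t = (s t)\<^sup>2" for f
  proof (rule no_affine[OF f])
    show "\<forall>\<^sub>F t in nhds 0. (cos (\<psi> t))\<^sup>2 = 1 + (- (of_real \<kappa>)\<^sup>2) * f t"
      using ev sin_eq
      by eventually_elim (simp add: assms(9) cos_squared_eq power_mult_distrib)
  qed
  ultimately show ?thesis by blast
qed

end
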